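(* Let $n\ge1$, let $\alpha,\varpi\in\mathbb{R}$ with $\alpha\neq0$ and $\alpha\neq-1$, and let $\Sigma$ be a cylindrical hypersurface of $\mathbb{R}^{n+1}$ with nonconstant mean curvature. If $\Sigma$ is a generalized singular minimal hypersurface for $\alpha,\varpi$, then $\Sigma$ is also a stationary hypersurface for $$m=-\alpha-1,\qquad \lambda=\frac{\varpi}{\alpha+1},$$ and some $\eta\neq0$.
   Context: A cylindrical hypersurface $\Sigma$ of $\mathbb{R}^{n+1}$ is one parameterized by $\phi(s,t)=\gamma(s)+\sum_{i=1}^{n-1}t_iw_i$, where $w_1,\ldots,w_{n-1}$ are (linearly independent) unit vectors and $\gamma$, the generating curve, is an arc-length parameterized curve in a plane orthogonal to all the $w_i$ (for $n=1$, $\Sigma=\gamma$). With $T=\gamma'$ and $N$ the counter-clockwise rotation of $T$ by $\pi/2$ in that plane, the curvature $\kappa$ is defined by $T'=\kappa N$; the unit normal of $\Sigma$ is $\nu(s,t)=N(s)$ and its mean curvature is $H=\kappa/n$. Hypersurfaces are taken in the upper half-space $\{x_{n+1}>0\}$ whenever this is necessary for the powers of $x_{n+1}$ involved to be defined. Generalized singular minimal hypersurface (for $\alpha\neq0$, $\varpi$): a hypersurface with unit normal $\nu=(\nu_1,\ldots,\nu_{n+1})$ whose mean curvature satisfies $$H=\frac{\alpha}{n}\frac{\nu_{n+1}}{x_{n+1}}+\frac{\varpi}{n}.$$ Stationary hypersurface (for $\eta\neq0$, $m\neq0$, $\lambda$): a hypersurface whose mean curvature satisfies $nH=\eta x_{n+1}^m+\lambda$.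 *)

theory Defs
  imports "HOL-Analysis.Analysis"
begin

text \<open>
  The ambient space is \<open>real ^ 'd\<close> with \<open>CARD('d) = n + 1\<close>; the height \<open>x\<^sub>n\<^sub>+\<^sub>1\<close> is the
  coordinate with a distinguished index \<open>l :: 'd\<close>. A hypersurface is given by a
  parametrization \<open>\<phi>\<close> on a parameter domain \<open>D\<close>, together with its unit normal \<open>\<nu>\<close> and its
  mean curvature \<open>H\<close> as functions of the parameters.
\<close>

subsection \<open>Real powers\<close>

text \<open>
  \<open>x powr m\<close> is the usual power only for \<open>x \<ge> 0\<close>; integral powers also make sense for
  negative \<open>x\<close>.
\<close>

definition power_defined :: "real \<Rightarrow> real \<Rightarrow> bool" where
  "power_defined x m \<longleftrightarrow> 0 < x \<or> (x = 0 \<and> 0 \<le> m) \<or> (x < 0 \<and> m \<in> \<int>)"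

definition real_power :: "real \<Rightarrow> real \<Rightarrow> real" where
  "real_power x m = (if m \<in> \<int> then x powi \<lfloor>m\<rfloor> else x powr m)"

lemma real_power_pos: "0 < x \<Longrightarrow> real_power x m = x powr m"
  by (auto simp: real_power_def powr_real_of_int' elim!: Ints_cases)


subsection \<open>Plane curves\<close>

definition tangent :: "(real \<Rightarrow> real ^ 'd) \<Rightarrow> real \<Rightarrow> real ^ 'd" where
  "tangent \<gamma> s = vector_derivative \<gamma> (at s)"

text \<open>
  Rotation by \<open>\<pi>/2\<close>, counter-clockwise with respect to the orientation given by the
  orthonormal basis \<open>(e\<^sub>1, e\<^sub>2)\<close> of the plane.
\<close>

definition rot90 :: "real ^ 'd \<Rightarrow> real ^ 'd \<Rightarrow> real ^ 'd \<Rightarrow> real ^ 'd" where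
  "rot90 e\<^sub>1 e\<^sub>2 v = (v \<bullet> e\<^sub>1) *\<^sub>R e\<^sub>2 - (v \<bullet> e\<^sub>2) *\<^sub>R e\<^sub>1"

definition curve_normal :: "real ^ 'd \<Rightarrow> real ^ 'd \<Rightarrow> (real \<Rightarrow> real ^ 'd) \<Rightarrow> real \<Rightarrow> real ^ 'd" where
  "curve_normal e\<^sub>1 e\<^sub>2 \<gamma> s = rot90 e\<^sub>1 e\<^sub>2 (tangent \<gamma> s)"

definition curvature :: "real ^ 'd \<Rightarrow> real ^ 'd \<Rightarrow> (real \<Rightarrow> real ^ 'd) \<Rightarrow> real \<Rightarrow> real" where
  "curvature e\<^sub>1 e\<^sub>2 \<gamma> s =
     (THE k. vector_derivative (tangent \<gamma>) (at s) = k *\<^sub>R curve_normal e\<^sub>1 e\<^sub>2 \<gamma> s)"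

text \<open>Two derivatives are the regularity needed for the curvature to make sense.\<close>

definition arclength_plane_curve ::
  "real set \<Rightarrow> real ^ 'd \<Rightarrow> real ^ 'd \<Rightarrow> (real \<Rightarrow> real ^ 'd) \<Rightarrow> bool" where
  "arclength_plane_curve I e\<^sub>1 e\<^sub>2 \<gamma> \<longleftrightarrow>
     norm e\<^sub>1 = 1 \<and> norm e\<^sub>2 = 1 \<and> e\<^sub>1 \<bullet> e\<^sub>2 = 0 \<and>
     (\<exists>c. \<forall>s\<in>I. \<gamma> s - c \<in> span {e\<^sub>1, e\<^sub>2}) \<and>
     (\<forall>s\<in>I. \<gamma> differentiable (at s) \<and> tangent \<gamma> differentiable (at s) \<and> norm (tangent \<gamma> s) = 1)"


subsection \<open>Cylindrical hypersurfaces\<close>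

definition cyl_param ::
  "nat \<Rightarrow> (real \<Rightarrow> real ^ 'd) \<Rightarrow> (nat \<Rightarrow> real ^ 'd) \<Rightarrow> real \<times> (nat \<Rightarrow> real) \<Rightarrow> real ^ 'd" where
  "cyl_param n \<gamma> w = (\<lambda>(s, t). \<gamma> s + (\<Sum>i<n-1. t i *\<^sub>R w i))"

definition cyl_normal ::
  "real ^ 'd \<Rightarrow> real ^ 'd \<Rightarrow> (real \<Rightarrow> real ^ 'd) \<Rightarrow> real \<times> (nat \<Rightarrow> real) \<Rightarrow> real ^ 'd" where
  "cyl_normal e\<^sub>1 e\<^sub>2 \<gamma> = (\<lambda>(s, t). curve_normal e\<^sub>1 e\<^sub>2 \<gamma> s)"

definition cyl_mean_curvature ::
  "nat \<Rightarrow> real ^ 'd \<Rightarrow> real ^ 'd \<Rightarrow> (real \<Rightarrow> real ^ 'd) \<Rightarrow> real \<times> (nat \<Rightarrow> real) \<Rightarrow> real" where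
  "cyl_mean_curvature n e\<^sub>1 e\<^sub>2 \<gamma> = (\<lambda>(s, t). curvature e\<^sub>1 e\<^sub>2 \<gamma> s / real n)"

text \<open>
  The parameters \<open>(s, t)\<close> range over a nonempty connected open subset \<open>D\<close> of
  \<open>\<real> \<times> \<real>\<^sup>n\<^sup>-\<^sup>1\<close>. This covers the complete cylinder, \<open>D = I \<times> \<real>\<^sup>n\<^sup>-\<^sup>1\<close> with an open
  interval \<open>I\<close>, and also the part of a cylinder with rulings that are not horizontal lying in
  the upper half-space. The curve matters only on the open interval \<open>fst ` D\<close>.
\<close>

definition cylindrical_hypersurface ::
  "nat \<Rightarrow> (real \<times> (nat \<Rightarrow> real)) set \<Rightarrow> real ^ 'd \<Rightarrow> real ^ 'd \<Rightarrow> (real \<Rightarrow> real ^ 'd) \<Rightarrow>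
   (nat \<Rightarrow> real ^ 'd) \<Rightarrow> bool" where
  "cylindrical_hypersurface n D e\<^sub>1 e\<^sub>2 \<gamma> w \<longleftrightarrow>
     D \<noteq> {} \<and>
     openin (prod_topology euclideanreal (Euclidean_space (n - 1))) D \<and>
     connectedin (prod_topology euclideanreal (Euclidean_space (n - 1))) D \<and>
     (\<forall>i<n-1. norm (w i) = 1 \<and> w i \<bullet> e\<^sub>1 = 0 \<and> w i \<bullet> e\<^sub>2 = 0) \<and>
     inj_on w {..<n-1} \<and> independent (w ` {..<n-1}) \<and>
     arclength_plane_curve (fst ` D) e\<^sub>1 e\<^sub>2 \<gamma>"


subsection \<open>Generalized singular minimal and stationary hypersurfaces\<close>

definition generalized_singular_minimal ::
  "nat \<Rightarrow> 'd \<Rightarrow> 'p set \<Rightarrow> ('p \<Rightarrow> real ^ 'd) \<Rightarrow> ('p \<Rightarrow> real ^ 'd) \<Rightarrow> ('p \<Rightarrow> real) \<Rightarrow>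
   real \<Rightarrow> real \<Rightarrow> bool" where
  "generalized_singular_minimal n l D \<phi> \<nu> H \<alpha> varpi \<longleftrightarrow>
     \<alpha> \<noteq> 0 \<and>
     (\<forall>p\<in>D. \<phi> p $ l \<noteq> 0 \<and>
       H p = \<alpha> / real n * (\<nu> p $ l / \<phi> p $ l) + varpi / real n)"

definition stationary_hypersurface ::
  "nat \<Rightarrow> 'd \<Rightarrow> 'p set \<Rightarrow> ('p \<Rightarrow> real ^ 'd) \<Rightarrow> ('p \<Rightarrow> real) \<Rightarrow>
   real \<Rightarrow> real \<Rightarrow> real \<Rightarrow> bool" where
  "stationary_hypersurface n l D \<phi> H \<eta> m lam \<longleftrightarrow>
     \<eta> \<noteq> 0 \<and> m \<noteq> 0 \<and>
     (\<forall>p\<in>D. power_defined (\<phi> p $ l) m \<and>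
       real n * H p = \<eta> * real_power (\<phi> p $ l) m + lam)"

end

theory Submission
  imports Defs
begin

text \<open>
  If a ruling direction is not horizontal, moving along that ruling changes the height
  \<open>x\<^sub>n\<^sub>+\<^sub>1\<close> but neither \<open>\<nu>\<close> nor \<open>H\<close>, so the singular minimal equation forces
  \<open>\<nu>\<^sub>n\<^sub>+\<^sub>1 = 0\<close> and hence \<open>H = \<varpi>/n\<close> everywhere (\<open>normal_height_eq_0\<close>). Nonconstant mean
  curvature therefore makes all rulings horizontal: the height is a function \<open>z\<close> of the
  arc-length \<open>s\<close> alone.

  Write \<open>f = \<nu>\<^sub>n\<^sub>+\<^sub>1\<close>. The Frenet equation \<open>N' = -\<kappa> T\<close> (\<open>curve_normal_derivative\<close>) gives
  \<open>f' = -\<kappa> z'\<close>, and the hypothesis is \<open>\<kappa> = \<alpha> f / z + \<varpi>\<close>. Putting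
  \<open>u = f / z + \<varpi> / (\<alpha> + 1)\<close>, where the shift absorbs the inhomogeneous term, turns it into \<open>\<kappa> = \<alpha> u + \<varpi> / (\<alpha> + 1)\<close>, and eliminating
  \<open>\<kappa>\<close> from \<open>u'\<close> leaves the linear equation \<open>u' = m (z'/z) u\<close> with \<open>m = -\<alpha> - 1\<close>. The
  power \<open>z\<^sup>m\<close> is a nowhere vanishing solution of the same equation, so \<open>u = C z\<^sup>m\<close> on the
  parameter interval (\<open>linear_ode_solutions_proportional\<close>). This is the stationary equation
  with \<open>\<eta> = \<alpha> C\<close>, and \<open>\<eta> = 0\<close> would make the curvature constant.
\<close>

section \<open>Powers of the height as solutions of a linear equation\<close>

lemma real_power_nonzero: "x \<noteq> 0 \<Longrightarrow> real_power x m \<noteq> 0"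
  by (auto simp: real_power_def)

text \<open>
  The logarithmic derivative \<open>m z'/z\<close> has the same form for both signs of the base, which
  treats cylinders below the hyperplane \<open>x\<^sub>n\<^sub>+\<^sub>1 = 0\<close> (integral \<open>m\<close>) together with those above.
\<close>

lemma has_real_derivative_real_power:
  assumes z: "(z has_real_derivative z') (at s)"
    and nz: "z s \<noteq> 0" and pd: "power_defined (z s) m"
  shows "((\<lambda>s. real_power (z s) m) has_real_derivative
           m * (z' / z s) * real_power (z s) m) (at s)"
proof (cases "m \<in> \<int>")
  case True
  then obtain k where k: "m = of_int k" by (elim Ints_cases)
  have "((\<lambda>s. z s powi k) has_real_derivative of_int k * z s powi (k - 1) * z') (at s)"
    using DERIV_power_int[OF z] nz by blast
  then show ?thesis
    using nz by (simp add: real_power_def k power_int_diff mult_ac)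
next
  case False
  then have pos: "z s > 0" using pd nz by (auto simp: power_defined_def)
  have "((\<lambda>s. z s powr m) has_real_derivative m * z s powr (m - 1) * z') (at s)"
    using DERIV_chain2[OF has_real_derivative_powr[OF pos] z] by simp
  then show ?thesis
    using False pos by (simp add: real_power_def powr_diff mult_ac)
qed

lemma linear_ode_solutions_proportional:
  fixes u p q :: "real \<Rightarrow> real"
  assumes I: "open I" "connected I"
    and u: "\<And>s. s \<in> I \<Longrightarrow> (u has_real_derivative q s * u s) (at s)"
    and p: "\<And>s. s \<in> I \<Longrightarrow> (p has_real_derivative q s * p s) (at s)"
    and nz: "\<And>s. s \<in> I \<Longrightarrow> p s \<noteq> 0"
  obtains c where "\<And>s. s \<in> I \<Longrightarrow> u s = c * p s"
proof -
  have d: "((\<lambda>s. u s / p s) has_real_derivative 0) (at s)" if "s \<in> I" for s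
    using DERIV_divide[OF u[OF that] p[OF that] nz[OF that]] by simp
  have "continuous_on I (\<lambda>s. u s / p s)"
    using d by (meson DERIV_continuous continuous_at_imp_continuous_on)
  then obtain c where "\<And>s. s \<in> I \<Longrightarrow> u s / p s = c"
    using DERIV_zero_connected_constant[OF I(2,1), of "{}"] d by auto
  then show ?thesis using that nz by (metis nonzero_eq_divide_eq)
qed

section \<open>The Frenet equation for the normal\<close>

lemma in_span_orthonormal_pair:
  fixes e\<^sub>1 e\<^sub>2 v :: "'a::euclidean_space"
  assumes "norm e\<^sub>1 = 1" "norm e\<^sub>2 = 1" "e\<^sub>1 \<bullet> e\<^sub>2 = 0"
  shows "v \<in> span {e\<^sub>1, e\<^sub>2} \<longleftrightarrow> (v \<bullet> e\<^sub>1) *\<^sub>R e\<^sub>1 + (v \<bullet> e\<^sub>2) *\<^sub>R e\<^sub>2 = v"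
proof
  assume "v \<in> span {e\<^sub>1, e\<^sub>2}"
  then obtain a b where "v = a *\<^sub>R e\<^sub>1 + b *\<^sub>R e\<^sub>2"
    by (force simp: span_breakdown_eq algebra_simps)
  moreover have "e\<^sub>1 \<bullet> e\<^sub>1 = 1" "e\<^sub>2 \<bullet> e\<^sub>2 = 1" "e\<^sub>2 \<bullet> e\<^sub>1 = 0"
    using assms by (auto simp: dot_square_norm inner_commute)
  ultimately show "(v \<bullet> e\<^sub>1) *\<^sub>R e\<^sub>1 + (v \<bullet> e\<^sub>2) *\<^sub>R e\<^sub>2 = v"
    using assms(3) by (simp add: inner_simps)
next
  assume "(v \<bullet> e\<^sub>1) *\<^sub>R e\<^sub>1 + (v \<bullet> e\<^sub>2) *\<^sub>R e\<^sub>2 = v"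
  moreover have "(v \<bullet> e\<^sub>1) *\<^sub>R e\<^sub>1 + (v \<bullet> e\<^sub>2) *\<^sub>R e\<^sub>2 \<in> span {e\<^sub>1, e\<^sub>2}"
    by (simp add: span_add span_base span_scale)
  ultimately show "v \<in> span {e\<^sub>1, e\<^sub>2}" by metis
qed

text \<open>
  The orthogonal projection onto the plane is bounded linear, so it commutes with
  differentiation and fixes the derivative of any curve it fixes up to translation.
\<close>

lemma derivative_in_plane:
  fixes e\<^sub>1 e\<^sub>2 c :: "'a::euclidean_space" and f :: "real \<Rightarrow> 'a"
  assumes e: "norm e\<^sub>1 = 1" "norm e\<^sub>2 = 1" "e\<^sub>1 \<bullet> e\<^sub>2 = 0"
    and I: "open I" "s \<in> I"
    and plane: "\<And>s. s \<in> I \<Longrightarrow> f s - c \<in> span {e\<^sub>1, e\<^sub>2}"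
    and f: "(f has_vector_derivative f') (at s)"
  shows "f' \<in> span {e\<^sub>1, e\<^sub>2}"
proof -
  define P where "P v = (v \<bullet> e\<^sub>1) *\<^sub>R e\<^sub>1 + (v \<bullet> e\<^sub>2) *\<^sub>R e\<^sub>2" for v
  have P: "bounded_linear P"
    unfolding P_def by (intro bounded_linear_intros)
  have fc: "((\<lambda>s. f s - c) has_vector_derivative f') (at s)"
    using has_vector_derivative_diff[OF f has_vector_derivative_const] by simp
  have "((\<lambda>s. P (f s - c)) has_vector_derivative P f') (at s)"
    by (rule bounded_linear.has_vector_derivative[OF P fc])
  moreover have "P (f s - c) = f s - c" if "s \<in> I" for s
    using plane[OF that] in_span_orthonormal_pair[OF e] by (simp add: P_def)
  ultimately have "((\<lambda>s. f s - c) has_vector_derivative P f') (at s)"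
    by (rule has_vector_derivative_transform_within_open[OF _ I])
  then have "P f' = f'" using fc vector_derivative_unique_at by blast
  then show ?thesis using in_span_orthonormal_pair[OF e] by (simp add: P_def)
qed

text \<open>
  In a plane, a vector orthogonal to a unit vector is a multiple of its quarter turn, and a
  second quarter turn is a reflection through the origin.
\<close>

lemma orthogonal_to_unit_in_plane:
  fixes e\<^sub>1 e\<^sub>2 t v :: "real ^ 'd"
  assumes e: "norm e\<^sub>1 = 1" "norm e\<^sub>2 = 1" "e\<^sub>1 \<bullet> e\<^sub>2 = 0"
    and t: "t \<in> span {e\<^sub>1, e\<^sub>2}" "norm t = 1"
    and v: "v \<in> span {e\<^sub>1, e\<^sub>2}" "t \<bullet> v = 0"
  obtains k where "v = k *\<^sub>R rot90 e\<^sub>1 e\<^sub>2 t" "rot90 e\<^sub>1 e\<^sub>2 v = (- k) *\<^sub>R t"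
    "rot90 e\<^sub>1 e\<^sub>2 t \<noteq> 0"
proof -
  define a b p q where "a = t \<bullet> e\<^sub>1" and "b = t \<bullet> e\<^sub>2" and "p = v \<bullet> e\<^sub>1" and "q = v \<bullet> e\<^sub>2"
  have te: "t = a *\<^sub>R e\<^sub>1 + b *\<^sub>R e\<^sub>2" and ve: "v = p *\<^sub>R e\<^sub>1 + q *\<^sub>R e\<^sub>2"
    using t(1) v(1) in_span_orthonormal_pair[OF e] by (simp_all add: a_def b_def p_def q_def)
  have ee: "e\<^sub>1 \<bullet> e\<^sub>1 = 1" "e\<^sub>2 \<bullet> e\<^sub>2 = 1" "e\<^sub>2 \<bullet> e\<^sub>1 = 0"
    using e by (auto simp: dot_square_norm inner_commute)
  have "t \<bullet> t = a * a + b * b" unfolding te using ee e(3) by (simp add: inner_simps)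
  then have 1: "a * a + b * b = 1" using t(2) by (simp add: dot_square_norm)
  have "t \<bullet> v = a * p + b * q" unfolding te ve using ee e(3) by (simp add: inner_simps)
  then have 2: "a * p + b * q = 0" using v(2) by simp
  define k where "k = a * q - b * p"
  have pk: "p = - k * b" and qk: "q = k * a"
    unfolding k_def using 1 2 by algebra+
  have rt: "rot90 e\<^sub>1 e\<^sub>2 t = a *\<^sub>R e\<^sub>2 - b *\<^sub>R e\<^sub>1" and rv: "rot90 e\<^sub>1 e\<^sub>2 v = p *\<^sub>R e\<^sub>2 - q *\<^sub>R e\<^sub>1"
    by (simp_all add: rot90_def a_def b_def p_def q_def)
  have "rot90 e\<^sub>1 e\<^sub>2 t \<bullet> rot90 e\<^sub>1 e\<^sub>2 t = a * a + b * b"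
    unfolding rt using ee e(3) by (simp add: inner_simps)
  then have "rot90 e\<^sub>1 e\<^sub>2 t \<noteq> 0" using 1 by force
  moreover have "v = k *\<^sub>R rot90 e\<^sub>1 e\<^sub>2 t"
    unfolding rt ve pk qk by (simp add: algebra_simps)
  moreover have "rot90 e\<^sub>1 e\<^sub>2 v = (- k) *\<^sub>R t"
    unfolding rv pk qk te by (simp add: algebra_simps)
  ultimately show ?thesis using that by blast
qed

lemma tangent_has_derivative:
  assumes "arclength_plane_curve I e\<^sub>1 e\<^sub>2 \<gamma>" "s \<in> I"
  shows "(\<gamma> has_vector_derivative tangent \<gamma> s) (at s)"
  using assms by (auto simp: arclength_plane_curve_def tangent_def vector_derivative_works)

text \<open>
  The curvature is a definite description; it denotes the expected number because \<open>T\<close> stays a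
  unit vector of a fixed plane, which makes \<open>T'\<close> a multiple of the nonzero vector \<open>N\<close>.
\<close>

lemma curve_normal_derivative:
  fixes \<gamma> :: "real \<Rightarrow> real ^ 'd::finite"
  assumes curve: "arclength_plane_curve I e\<^sub>1 e\<^sub>2 \<gamma>" and I: "open I" "s \<in> I"
  shows "(curve_normal e\<^sub>1 e\<^sub>2 \<gamma> has_vector_derivative
           (- curvature e\<^sub>1 e\<^sub>2 \<gamma> s) *\<^sub>R tangent \<gamma> s) (at s)"
proof -
  define T' where "T' = vector_derivative (tangent \<gamma>) (at s)"
  have e: "norm e\<^sub>1 = 1" "norm e\<^sub>2 = 1" "e\<^sub>1 \<bullet> e\<^sub>2 = 0"
    using curve by (auto simp: arclength_plane_curve_def)
  obtain c where c: "\<And>s. s \<in> I \<Longrightarrow> \<gamma> s - c \<in> span {e\<^sub>1, e\<^sub>2}"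
    using curve by (auto simp: arclength_plane_curve_def)
  have unit: "norm (tangent \<gamma> s) = 1" if "s \<in> I" for s
    using curve that by (auto simp: arclength_plane_curve_def)
  have T: "tangent \<gamma> s \<in> span {e\<^sub>1, e\<^sub>2}" if "s \<in> I" for s
    using derivative_in_plane[OF e I(1) that c tangent_has_derivative[OF curve that]] .
  have dT: "(tangent \<gamma> has_vector_derivative T') (at s)"
    using curve I(2) by (auto simp: arclength_plane_curve_def T'_def vector_derivative_works)
  have T'_plane: "T' \<in> span {e\<^sub>1, e\<^sub>2}"
    by (rule derivative_in_plane[OF e I, of "tangent \<gamma>" 0]) (use T dT in auto)
  have "((\<lambda>s. tangent \<gamma> s \<bullet> tangent \<gamma> s) has_vector_derivative
          tangent \<gamma> s \<bullet> T' + T' \<bullet> tangent \<gamma> s) (at s)"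
    by (rule bounded_bilinear.has_vector_derivative[OF bounded_bilinear_inner dT dT])
  then have "((\<lambda>s. 1) has_vector_derivative tangent \<gamma> s \<bullet> T' + T' \<bullet> tangent \<gamma> s) (at s)"
    by (rule has_vector_derivative_transform_within_open[OF _ I])
      (simp add: dot_square_norm unit)
  then have "tangent \<gamma> s \<bullet> T' + T' \<bullet> tangent \<gamma> s = 0"
    using vector_derivative_unique_at has_vector_derivative_const by blast
  then have orth: "tangent \<gamma> s \<bullet> T' = 0" by (simp add: inner_commute)
  obtain k where k: "T' = k *\<^sub>R curve_normal e\<^sub>1 e\<^sub>2 \<gamma> s"
      "rot90 e\<^sub>1 e\<^sub>2 T' = (- k) *\<^sub>R tangent \<gamma> s" "curve_normal e\<^sub>1 e\<^sub>2 \<gamma> s \<noteq> 0"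
    using orthogonal_to_unit_in_plane[OF e T[OF I(2)] unit[OF I(2)] T'_plane orth]
    unfolding curve_normal_def by blast
  have curv: "curvature e\<^sub>1 e\<^sub>2 \<gamma> s = k"
    unfolding curvature_def by (rule the_equality) (use k T'_def in auto)
  have "bounded_linear (rot90 e\<^sub>1 e\<^sub>2)"
    unfolding rot90_def by (intro bounded_linear_intros)
  from bounded_linear.has_vector_derivative[OF this dT] show ?thesis
    unfolding curve_normal_def[abs_def] curv using k(2) by simp
qed

section \<open>The parameter domain of a cylinder\<close>

lemma fst_image_openin_open:
  assumes "openin (prod_topology euclidean Y) D"
  shows "open (fst ` D)"
  using open_map_fst assms by (metis open_map_def open_openin)

lemma fst_image_connectedin_connected:
  assumes "connectedin (prod_topology euclidean Y) D"
  shows "connected (fst ` D)"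
  using connectedin_continuous_map_image[OF continuous_map_fst assms] by simp

text \<open>
  Slices of an open parameter domain in the direction of a ruling are open, so they contain
  more than one point.
\<close>

lemma openin_move_along_ruling:
  assumes D: "openin (prod_topology euclideanreal (Euclidean_space k)) D"
    and st: "(s, t) \<in> D" and i: "i < k"
  obtains h where "h \<noteq> (0::real)" "(s, t(i := t i + h)) \<in> D"
proof -
  let ?X = "prod_topology euclideanreal (Euclidean_space k)"
  have "(s, t) \<in> topspace ?X" using D st openin_subset by blast
  then have t: "\<forall>j\<ge>k. t j = 0" by (simp add: topspace_Euclidean_space)
  let ?g = "\<lambda>h. (s, t(i := t i + h))"
  have "continuous_map euclideanreal (powertop_real UNIV) (\<lambda>h. t(i := t i + h))"
    unfolding continuous_map_componentwise_UNIV
  proof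
    show "continuous_map euclideanreal euclideanreal (\<lambda>h. (t(i := t i + h)) j)" for j
      by (cases "j = i") (auto intro!: continuous_intros)
  qed
  then have "continuous_map euclideanreal ?X ?g"
    using t i
    by (auto simp: continuous_map_pairwise o_def Euclidean_space_def continuous_map_in_subtopology)
  from openin_continuous_map_preimage[OF this D] have "open {h. ?g h \<in> D}"
    by simp
  moreover have "0 \<in> {h. ?g h \<in> D}" using st by simp
  ultimately have "{h. ?g h \<in> D} \<noteq> {0}"
    using not_open_singleton[of "0::real"] by metis
  with \<open>0 \<in> {h. ?g h \<in> D}\<close> have "\<exists>h\<in>{h. ?g h \<in> D}. h \<noteq> 0" by blast
  then show ?thesis using that by auto
qed

section \<open>Rulings\<close>

text \<open>
  Two points on one ruling have equal mean curvature, hence by \<open>\<alpha> \<noteq> 0\<close> equal quotients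
  \<open>\<nu>\<^sub>n\<^sub>+\<^sub>1 / x\<^sub>n\<^sub>+\<^sub>1\<close>. The numerators agree as well, but the denominators differ.
\<close>

lemma normal_height_eq_0:
  assumes cyl: "cylindrical_hypersurface n D e\<^sub>1 e\<^sub>2 \<gamma> w"
    and gsm: "generalized_singular_minimal n l D (cyl_param n \<gamma> w) (cyl_normal e\<^sub>1 e\<^sub>2 \<gamma>)
           (cyl_mean_curvature n e\<^sub>1 e\<^sub>2 \<gamma>) \<alpha> varpi"
    and i: "i < n - 1" "w i $ l \<noteq> 0" and p: "p \<in> D"
  shows "cyl_normal e\<^sub>1 e\<^sub>2 \<gamma> p $ l = 0"
proof (rule ccontr)
  assume nz: "cyl_normal e\<^sub>1 e\<^sub>2 \<gamma> p $ l \<noteq> 0"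
  obtain s t where st: "p = (s, t)" by (cases p)
  obtain h where h: "h \<noteq> 0" "(s, t(i := t i + h)) \<in> D"
    using openin_move_along_ruling[OF _ _ i(1)] cyl p
    unfolding cylindrical_hypersurface_def st by blast
  let ?q = "(s, t(i := t i + h))" and ?x = "\<lambda>p. cyl_param n \<gamma> w p $ l"
  have "(\<Sum>j<n-1. (t(i := t i + h)) j *\<^sub>R w j)
      = (\<Sum>j<n-1. t j *\<^sub>R w j + (if j = i then h *\<^sub>R w i else 0))"
    by (rule sum.cong) (auto simp: algebra_simps)
  also have "\<dots> = (\<Sum>j<n-1. t j *\<^sub>R w j) + h *\<^sub>R w i"
    using i(1) by (simp add: sum.distrib)
  finally have x: "?x ?q = ?x p + h * w i $ l"
    by (simp add: cyl_param_def st)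
  have n: "n > 0" using i(1) by simp
  have eq: "cyl_mean_curvature n e\<^sub>1 e\<^sub>2 \<gamma> r
          = \<alpha> / real n * (cyl_normal e\<^sub>1 e\<^sub>2 \<gamma> r $ l / ?x r) + varpi / real n"
      "?x r \<noteq> 0" if "r \<in> D" for r
    using gsm that by (auto simp: generalized_singular_minimal_def)
  have "\<alpha> \<noteq> 0" using gsm by (simp add: generalized_singular_minimal_def)
  moreover have "cyl_mean_curvature n e\<^sub>1 e\<^sub>2 \<gamma> ?q = cyl_mean_curvature n e\<^sub>1 e\<^sub>2 \<gamma> p"
    "cyl_normal e\<^sub>1 e\<^sub>2 \<gamma> ?q = cyl_normal e\<^sub>1 e\<^sub>2 \<gamma> p"
    by (simp_all add: st cyl_mean_curvature_def cyl_normal_def)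
  ultimately have "cyl_normal e\<^sub>1 e\<^sub>2 \<gamma> p $ l / ?x ?q = cyl_normal e\<^sub>1 e\<^sub>2 \<gamma> p $ l / ?x p"
    using eq(1)[OF p] eq(1)[OF h(2)] n by simp
  then have "?x ?q = ?x p" using nz eq(2)[OF p] eq(2)[OF h(2)] by (simp add: field_simps)
  then show False using x h(1) i(2) by simp
qed

section \<open>Singular minimal cylinders are stationary\<close>

theorem theorem5p3:
  fixes n :: nat and l :: "'d::finite" and \<alpha> varpi :: real
    and D :: "(real \<times> (nat \<Rightarrow> real)) set"
    and e\<^sub>1 e\<^sub>2 :: "real ^ 'd" and \<gamma> :: "real \<Rightarrow> real ^ 'd" and w :: "nat \<Rightarrow> real ^ 'd"
  assumes "n \<ge> 1" and "CARD('d) = n + 1"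
    and "\<alpha> \<noteq> 0" and "\<alpha> \<noteq> -1"
    and "cylindrical_hypersurface n D e\<^sub>1 e\<^sub>2 \<gamma> w"
    and "\<forall>p\<in>D. power_defined (cyl_param n \<gamma> w p $ l) (- \<alpha> - 1)"
    and "\<not> cyl_mean_curvature n e\<^sub>1 e\<^sub>2 \<gamma> constant_on D"
    and "generalized_singular_minimal n l D (cyl_param n \<gamma> w) (cyl_normal e\<^sub>1 e\<^sub>2 \<gamma>)
           (cyl_mean_curvature n e\<^sub>1 e\<^sub>2 \<gamma>) \<alpha> varpi"
  shows "\<exists>\<eta>. \<eta> \<noteq> 0 \<and>
           stationary_hypersurface n l D (cyl_param n \<gamma> w)
             (cyl_mean_curvature n e\<^sub>1 e\<^sub>2 \<gamma>) \<eta> (- \<alpha> - 1) (varpi / (\<alpha> + 1))"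
proof -
  note n = assms(1) and \<alpha> = assms(3,4) and cyl = assms(5) and pd = assms(6)
    and nonconst = assms(7) and gsm = assms(8)
  define I where "I = fst ` D"
  define m where "m = - \<alpha> - 1"
  define z where "z s = \<gamma> s $ l" for s
  define f where "f s = curve_normal e\<^sub>1 e\<^sub>2 \<gamma> s $ l" for s
  define \<kappa> where "\<kappa> s = curvature e\<^sub>1 e\<^sub>2 \<gamma> s" for s
  define u where "u s = f s / z s + varpi / (\<alpha> + 1)" for s
  have I: "open I" "connected I" and curve: "arclength_plane_curve I e\<^sub>1 e\<^sub>2 \<gamma>"
    using cyl fst_image_openin_open fst_image_connectedin_connected
    unfolding cylindrical_hypersurface_def I_def by blast+
  have horizontal: "w i $ l = 0" if i: "i < n - 1" for i
  proof (rule ccontr)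
    assume nz: "w i $ l \<noteq> 0"
    have "cyl_mean_curvature n e\<^sub>1 e\<^sub>2 \<gamma> p = varpi / real n" if "p \<in> D" for p
      using gsm normal_height_eq_0[OF cyl gsm i nz that] that
      by (simp add: generalized_singular_minimal_def)
    then show False using nonconst unfolding constant_on_def by blast
  qed
  have height: "cyl_param n \<gamma> w (s, t) $ l = z s" for s t
    by (simp add: cyl_param_def z_def horizontal)
  have nH: "real n * cyl_mean_curvature n e\<^sub>1 e\<^sub>2 \<gamma> (s, t) = \<kappa> s" for s t
    using n by (simp add: cyl_mean_curvature_def \<kappa>_def)
  have \<kappa>_eq: "\<kappa> s = \<alpha> * (f s / z s) + varpi" and z_nz: "z s \<noteq> 0"
    and z_pd: "power_defined (z s) m" if s: "s \<in> I" for s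
  proof -
    obtain t where t: "(s, t) \<in> D" using s by (auto simp: I_def)
    show "z s \<noteq> 0" "power_defined (z s) m"
      using gsm pd t height by (auto simp: generalized_singular_minimal_def m_def)
    have "cyl_mean_curvature n e\<^sub>1 e\<^sub>2 \<gamma> (s, t) = \<alpha> / real n * (f s / z s) + varpi / real n"
      using gsm t height by (auto simp: generalized_singular_minimal_def cyl_normal_def f_def)
    then have "real n * cyl_mean_curvature n e\<^sub>1 e\<^sub>2 \<gamma> (s, t) = \<alpha> * (f s / z s) + varpi"
      using n by (simp add: field_simps)
    then show "\<kappa> s = \<alpha> * (f s / z s) + varpi" by (simp only: nH)
  qed
  have \<kappa>_u: "\<kappa> s = \<alpha> * u s + varpi / (\<alpha> + 1)" if "s \<in> I" for s
  proof -
    have "\<alpha> * (varpi / (\<alpha> + 1)) + varpi / (\<alpha> + 1) = varpi"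
      using \<alpha>(2) by (simp add: divide_simps) (simp add: algebra_simps)
    then show ?thesis using \<kappa>_eq[OF that] by (simp add: u_def distrib_left)
  qed
  define z' where "z' s = tangent \<gamma> s $ l" for s
  have component: "bounded_linear (\<lambda>v. v $ l)" for l :: 'd
    by (rule bounded_linear_vec_nth)
  have dz: "(z has_real_derivative z' s) (at s)" if "s \<in> I" for s
    using bounded_linear.has_vector_derivative[OF component tangent_has_derivative[OF curve that]]
    by (simp add: z_def[abs_def] z'_def has_real_derivative_iff_has_vector_derivative)
  have df: "(f has_real_derivative - \<kappa> s * z' s) (at s)" if "s \<in> I" for s
    using bounded_linear.has_vector_derivative
      [OF component curve_normal_derivative[OF curve I(1) that]]
    by (simp add: f_def[abs_def] z'_def \<kappa>_def has_real_derivative_iff_has_vector_derivative)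
  have du: "(u has_real_derivative m * (z' s / z s) * u s) (at s)" if s: "s \<in> I" for s
  proof -
    have m_neg: "m = - (\<alpha> + 1)" by (simp add: m_def)
    have "(u has_real_derivative (- \<kappa> s * z' s * z s - f s * z' s) / (z s * z s)) (at s)"
      unfolding u_def[abs_def]
      using DERIV_add[OF DERIV_divide[OF df[OF s] dz[OF s] z_nz[OF s]] DERIV_const] by simp
    also have "(- \<kappa> s * z' s * z s - f s * z' s) / (z s * z s)
        = - (z' s / z s) * (\<kappa> s + f s / z s)"
      using z_nz[OF s] by (simp add: field_simps)
    also have "\<kappa> s + f s / z s = (\<alpha> + 1) * u s"
      using \<kappa>_u[OF s] u_def[of s] distrib_right[of \<alpha> 1 "u s"] by linarith
    also have "- (z' s / z s) * ((\<alpha> + 1) * u s) = m * (z' s / z s) * u s"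
      using m_neg by (simp only: mult_minus_left mult_minus_right mult_ac)
    finally show ?thesis .
  qed
  obtain C where C: "\<And>s. s \<in> I \<Longrightarrow> u s = C * real_power (z s) m"
  proof (rule linear_ode_solutions_proportional)
    show "open I" "connected I" by (fact I)+
    show "(u has_real_derivative m * (z' s / z s) * u s) (at s)"
      and "((\<lambda>s. real_power (z s) m) has_real_derivative
             m * (z' s / z s) * real_power (z s) m) (at s)"
      and "real_power (z s) m \<noteq> 0" if s: "s \<in> I" for s
      using du[OF s] has_real_derivative_real_power[OF dz[OF s] z_nz[OF s] z_pd[OF s]]
        real_power_nonzero[OF z_nz[OF s]] by auto
  qed (rule that)
  have \<kappa>_C: "\<kappa> s = \<alpha> * C * real_power (z s) m + varpi / (\<alpha> + 1)" if "s \<in> I" for s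
    using \<kappa>_u[OF that] C[OF that] by simp
  have "C \<noteq> 0"
  proof
    assume "C = 0"
    then have "cyl_mean_curvature n e\<^sub>1 e\<^sub>2 \<gamma> p = varpi / (\<alpha> + 1) / real n" if "p \<in> D" for p
      using \<kappa>_C[of "fst p"] imageI[OF that, of fst] unfolding I_def[symmetric]
      by (simp add: cyl_mean_curvature_def \<kappa>_def case_prod_beta)
    then show False using nonconst unfolding constant_on_def by blast
  qed
  have "power_defined (cyl_param n \<gamma> w p $ l) m \<and>
      real n * cyl_mean_curvature n e\<^sub>1 e\<^sub>2 \<gamma> p
        = \<alpha> * C * real_power (cyl_param n \<gamma> w p $ l) m + varpi / (\<alpha> + 1)" if p: "p \<in> D" for p
  proof -
    obtain s t where st: "p = (s, t)" by (cases p)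
    have "s \<in> I" using p unfolding I_def st by (rule rev_image_eqI) simp
    then show ?thesis unfolding st height nH using z_pd \<kappa>_C by blast
  qed
  then have "stationary_hypersurface n l D (cyl_param n \<gamma> w) (cyl_mean_curvature n e\<^sub>1 e\<^sub>2 \<gamma>)
      (\<alpha> * C) m (varpi / (\<alpha> + 1))"
    using \<alpha> \<open>C \<noteq> 0\<close> by (simp add: stationary_hypersurface_def m_def)
  then show ?thesis using \<open>C \<noteq> 0\<close> \<alpha>(1) unfolding m_def by (intro exI[of _ "\<alpha> * C"]) simp
qed

end
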